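(* Let $(\Omega,\mathcal{A},\mu)$ be a measure space. The following properties are equivalent: (a) $\mu(\Omega)=\infty$. (b) $\mathcal{S}_u\setminus\bigcup_{q>0}\mathcal{S}_{L_q}\neq\varnothing$. (c) $\mathcal{S}_u\setminus\bigcup_{q>0}\mathcal{S}_{L_q}$ is strongly $\mathfrak{c}$-algebrable. In particular, if $\mu(\Omega)=\infty$, then the sets $\mathcal{S}_p\setminus\bigcup_{q>0}\mathcal{S}_{L_q}$, $\mathcal{S}_m\setminus\bigcup_{q>0}\mathcal{S}_{L_q}$ and $\mathcal{S}_{au}\setminus\bigcup_{q>0}\mathcal{S}_{L_q}$ are strongly $\mathfrak{c}$-algebrable.
   Context: $(\Omega,\mathcal{A},\mu)$ is a positive measure space with $\mu(\Omega)>0$. $L_0$ is the real vector space of ($\mu$-a.e. equality classes of) measurable functions $f:\Omega\to\mathbb{R}$. $L_0^{\mathbb{N}}$ is the commutative real algebra of all sequences $(f_n)_{n\in\mathbb{N}}$ in $L_0$ with coordinatewise operations, in particular $(f_n)\cdot(g_n):=(f_ng_n)$. Subsets of $L_0^{\mathbb{N}}$: $\mathcal{S}_p$: sequences with $f_n\to0$ pointwise almost everywhere. $\mathcal{S}_u$: $f_n\to0$ uniformly almost everywhere (there is $Z\in\mathcal{A}$ with $\mu(Z)=0$ and $f_n\to0$ uniformly on $\Omega\setminus Z$). $\mathcal{S}_{au}$: $f_n\to0$ almost uniformly (for every $\varepsilon>0$ there is $Z_\varepsilon\in\mathcal{A}$ with $\mu(Z_\varepsilon)<\varepsilon$ and $f_n\to0$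 uniformly on $\Omega\setminus Z_\varepsilon$). $\mathcal{S}_m$: $f_n\to0$ in measure ($\lim_n\mu(\{|f_n|>\varepsilon\})=0$ for every $\varepsilon>0$). $\mathcal{S}_{L_q}$ ($q\in(0,+\infty)$): $\lim_n\int_\Omega|f_n|^q\,d\mu=0$. $\mathfrak{c}$ is the cardinality of the continuum. A subset $A$ of a commutative algebra is strongly $\mathfrak{c}$-algebrable if there is a $\mathfrak{c}$-generated free algebra $M$ with $M\setminus\{0\}\subset A$; that is, there is a subset $B$ of the algebra of cardinality $\mathfrak{c}$ such that for any positive integer $N$, any nonzero real polynomial $P$ in $N$ variables without constant term and any distinct $x_1,\dots,x_N\in B$, one has $P(x_1,\dots,x_N)\in A\setminus\{0\}$. *)

theory Defs
  imports
    "HOL-Analysis.Analysis"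
    "HOL-Algebra.Module"
    "HOL-Library.Poly_Mapping"
    "HOL-Library.Equipollence"
begin

section \<open>The algebra of sequences of classes of measurable functions\<close>

definition ae_eq :: "'a measure \<Rightarrow> (('a \<Rightarrow> real) \<times> ('a \<Rightarrow> real)) set" where
  "ae_eq M = {(f, g). f \<in> borel_measurable M \<and> g \<in> borel_measurable M \<and> (AE x in M. f x = g x)}"

definition ae_class :: "'a measure \<Rightarrow> ('a \<Rightarrow> real) \<Rightarrow> ('a \<Rightarrow> real) set" where
  "ae_class M f = ae_eq M `` {f}"

text \<open>The unions below are over a single class each, since the operations respect
  \<^const>\<open>ae_eq\<close>; see \<open>L0_ops\<close>.\<close>

definition L0 :: "'a measure \<Rightarrow> (real, ('a \<Rightarrow> real) set) module" where
  "L0 M = \<lparr>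
     carrier = borel_measurable M // ae_eq M,
     mult = (\<lambda>F G. \<Union>f\<in>F. \<Union>g\<in>G. ae_class M (\<lambda>x. f x * g x)),
     one = ae_class M (\<lambda>x. 1),
     zero = ae_class M (\<lambda>x. 0),
     add = (\<lambda>F G. \<Union>f\<in>F. \<Union>g\<in>G. ae_class M (\<lambda>x. f x + g x)),
     smult = (\<lambda>c F. \<Union>f\<in>F. ae_class M (\<lambda>x. c * f x)) \<rparr>"

definition seq_algebra :: "('k, 'b) module \<Rightarrow> ('k, nat \<Rightarrow> 'b) module" where
  "seq_algebra A = \<lparr>
     carrier = UNIV \<rightarrow> carrier A,
     mult = (\<lambda>s t n. s n \<otimes>\<^bsub>A\<^esub> t n),
     one = (\<lambda>n. \<one>\<^bsub>A\<^esub>),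
     zero = (\<lambda>n. \<zero>\<^bsub>A\<^esub>),
     add = (\<lambda>s t n. s n \<oplus>\<^bsub>A\<^esub> t n),
     smult = (\<lambda>c s n. c \<odot>\<^bsub>A\<^esub> s n) \<rparr>"


section \<open>Modes of convergence to zero\<close>

definition seq_class :: "'a measure \<Rightarrow> (nat \<Rightarrow> 'a \<Rightarrow> real) \<Rightarrow> (nat \<Rightarrow> ('a \<Rightarrow> real) set)" where
  "seq_class M f = (\<lambda>n. ae_class M (f n))"

definition S_p :: "'a measure \<Rightarrow> (nat \<Rightarrow> ('a \<Rightarrow> real) set) set" where
  "S_p M = {seq_class M f | f. (\<forall>n. f n \<in> borel_measurable M) \<and>
     (AE x in M. (\<lambda>n. f n x) \<longlonglongrightarrow> 0)}"

definition S_u :: "'a measure \<Rightarrow> (nat \<Rightarrow> ('a \<Rightarrow> real) set) set" where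
  "S_u M = {seq_class M f | f. (\<forall>n. f n \<in> borel_measurable M) \<and>
     (\<exists>Z\<in>sets M. emeasure M Z = 0 \<and> uniform_limit (space M - Z) f (\<lambda>x. 0) sequentially)}"

definition S_au :: "'a measure \<Rightarrow> (nat \<Rightarrow> ('a \<Rightarrow> real) set) set" where
  "S_au M = {seq_class M f | f. (\<forall>n. f n \<in> borel_measurable M) \<and>
     (\<forall>\<epsilon>>0. \<exists>Z\<in>sets M. emeasure M Z < ennreal \<epsilon> \<and>
        uniform_limit (space M - Z) f (\<lambda>x. 0) sequentially)}"

definition S_m :: "'a measure \<Rightarrow> (nat \<Rightarrow> ('a \<Rightarrow> real) set) set" where
  "S_m M = {seq_class M f | f. (\<forall>n. f n \<in> borel_measurable M) \<and>
     (\<forall>\<epsilon>>0. (\<lambda>n. emeasure M {x \<in> space M. \<bar>f n x\<bar> > \<epsilon>}) \<longlonglongrightarrow> 0)}"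

definition S_L :: "'a measure \<Rightarrow> real \<Rightarrow> (nat \<Rightarrow> ('a \<Rightarrow> real) set) set" where
  "S_L M q = {seq_class M f | f. (\<forall>n. f n \<in> borel_measurable M) \<and>
     (\<lambda>n. \<integral>\<^sup>+ x. ennreal (\<bar>f n x\<bar> powr q) \<partial>M) \<longlonglongrightarrow> 0}"


section \<open>Strong algebrability\<close>

text \<open>A real polynomial in the variables with indices \<open>0, \<dots>, N - 1\<close> is an element \<open>P\<close> of
  \<^typ>\<open>(nat \<Rightarrow>\<^sub>0 nat) \<Rightarrow>\<^sub>0 real\<close>: its keys are the exponent vectors of the monomials occurring in \<open>P\<close>.\<close>

definition polynomial_in :: "nat \<Rightarrow> ((nat \<Rightarrow>\<^sub>0 nat) \<Rightarrow>\<^sub>0 real) \<Rightarrow> bool" where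
  "polynomial_in N P \<longleftrightarrow> (\<forall>m \<in> Poly_Mapping.keys P. Poly_Mapping.keys m \<subseteq> {..<N})"

definition poly_eval ::
  "(real, 'b) module \<Rightarrow> nat \<Rightarrow> ((nat \<Rightarrow>\<^sub>0 nat) \<Rightarrow>\<^sub>0 real) \<Rightarrow> (nat \<Rightarrow> 'b) \<Rightarrow> 'b" where
  "poly_eval A N P x =
     (\<Oplus>\<^bsub>A\<^esub> m \<in> Poly_Mapping.keys P.
        Poly_Mapping.lookup P m \<odot>\<^bsub>A\<^esub> (\<Otimes>\<^bsub>A\<^esub> i \<in> {..<N}. x i [^]\<^bsub>A\<^esub> Poly_Mapping.lookup m i))"

definition strongly_continuum_algebrable :: "(real, 'b) module \<Rightarrow> 'b set \<Rightarrow> bool" where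
  "strongly_continuum_algebrable A S \<longleftrightarrow>
     (\<exists>B \<subseteq> carrier A. B \<approx> (UNIV :: real set) \<and>
        (\<forall>N P x. N > 0 \<and> polynomial_in N P \<and> P \<noteq> 0 \<and> Poly_Mapping.lookup P 0 = 0 \<and>
           inj_on x {..<N} \<and> x ` {..<N} \<subseteq> B \<longrightarrow>
           poly_eval A N P x \<in> S - {\<zero>\<^bsub>A\<^esub>}))"


section \<open>Well-definedness\<close>

lemma equiv_ae_eq: "equiv (borel_measurable M) (ae_eq M)"
proof (rule equivI)
  show "trans (ae_eq M)"
  proof (rule transI)
    fix f g h assume "(f, g) \<in> ae_eq M" "(g, h) \<in> ae_eq M"
    then show "(f, h) \<in> ae_eq M"
      unfolding ae_eq_def by (auto elim: AE_mp)
  qed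
qed (auto simp: ae_eq_def refl_on_def sym_def eq_commute)

lemma ae_class_eq_iff:
  assumes "f \<in> borel_measurable M" "g \<in> borel_measurable M"
  shows "ae_class M f = ae_class M g \<longleftrightarrow> (AE x in M. f x = g x)"
  using eq_equiv_class_iff[OF equiv_ae_eq assms] assms
  by (simp add: ae_class_def ae_eq_def)

lemma ae_class_eqI:
  assumes "f \<in> borel_measurable M" "g \<in> borel_measurable M" "AE x in M. f x = g x"
  shows "ae_class M f = ae_class M g"
  using ae_class_eq_iff assms by blast

lemma mem_ae_class:
  "g \<in> ae_class M f \<longleftrightarrow>
     f \<in> borel_measurable M \<and> g \<in> borel_measurable M \<and> (AE x in M. f x = g x)"
  by (simp add: ae_class_def ae_eq_def)

lemma carrier_L0: "carrier (L0 M) = ae_class M ` borel_measurable M"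
  by (auto simp: L0_def quotient_def ae_class_def)

lemma L0_ops:
  assumes [measurable]: "f \<in> borel_measurable M" "g \<in> borel_measurable M"
  shows "ae_class M f \<otimes>\<^bsub>L0 M\<^esub> ae_class M g = ae_class M (\<lambda>x. f x * g x)"
    and "ae_class M f \<oplus>\<^bsub>L0 M\<^esub> ae_class M g = ae_class M (\<lambda>x. f x + g x)"
    and "c \<odot>\<^bsub>L0 M\<^esub> ae_class M f = ae_class M (\<lambda>x. c * f x)"
proof -
  have ne: "f \<in> ae_class M f" "g \<in> ae_class M g"
    by (auto simp: mem_ae_class)
  have m: "ae_class M (\<lambda>x. f' x * g' x) = ae_class M (\<lambda>x. f x * g x)"
    and a: "ae_class M (\<lambda>x. f' x + g' x) = ae_class M (\<lambda>x. f x + g x)"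
    and s: "ae_class M (\<lambda>x. c * f' x) = ae_class M (\<lambda>x. c * f x)"
    if "f' \<in> ae_class M f" "g' \<in> ae_class M g" for f' g'
  proof -
    have [measurable]: "f' \<in> borel_measurable M" "g' \<in> borel_measurable M"
      and "AE x in M. f x = f' x" "AE x in M. g x = g' x"
      using that by (auto simp: mem_ae_class)
    then have ae: "AE x in M. f x = f' x \<and> g x = g' x"
      by auto
    show "ae_class M (\<lambda>x. f' x * g' x) = ae_class M (\<lambda>x. f x * g x)"
      by (rule ae_class_eqI) (measurable, use ae in eventually_elim, simp)
    show "ae_class M (\<lambda>x. f' x + g' x) = ae_class M (\<lambda>x. f x + g x)"
      by (rule ae_class_eqI) (measurable, use ae in eventually_elim, simp)
    show "ae_class M (\<lambda>x. c * f' x) = ae_class M (\<lambda>x. c * f x)"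
      by (rule ae_class_eqI) (measurable, use ae in eventually_elim, simp)
  qed
  have "ae_class M f \<otimes>\<^bsub>L0 M\<^esub> ae_class M g =
      (\<Union>f'\<in>ae_class M f. \<Union>g'\<in>ae_class M g. ae_class M (\<lambda>x. f x * g x))"
    unfolding L0_def monoid.simps by (intro SUP_cong refl m)
  then show "ae_class M f \<otimes>\<^bsub>L0 M\<^esub> ae_class M g = ae_class M (\<lambda>x. f x * g x)"
    using ne by auto
  have "ae_class M f \<oplus>\<^bsub>L0 M\<^esub> ae_class M g =
      (\<Union>f'\<in>ae_class M f. \<Union>g'\<in>ae_class M g. ae_class M (\<lambda>x. f x + g x))"
    unfolding L0_def ring.simps by (intro SUP_cong refl a)
  then show "ae_class M f \<oplus>\<^bsub>L0 M\<^esub> ae_class M g = ae_class M (\<lambda>x. f x + g x)"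
    using ne by auto
  have "c \<odot>\<^bsub>L0 M\<^esub> ae_class M f = (\<Union>f'\<in>ae_class M f. ae_class M (\<lambda>x. c * f x))"
    unfolding L0_def module.simps by (intro SUP_cong refl s[OF _ ne(2)])
  then show "c \<odot>\<^bsub>L0 M\<^esub> ae_class M f = ae_class M (\<lambda>x. c * f x)"
    using ne by auto
qed

lemma L0_units:
  "\<one>\<^bsub>L0 M\<^esub> = ae_class M (\<lambda>x. 1)" "\<zero>\<^bsub>L0 M\<^esub> = ae_class M (\<lambda>x. 0)"
  by (simp_all add: L0_def)

definition real_ring :: "real ring" where
  "real_ring = \<lparr>carrier = UNIV, mult = (*), one = 1, zero = 0, add = (+)\<rparr>"

lemma cring_real_ring: "cring real_ring"
proof (rule cringI)
  show "abelian_group real_ring"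
  proof (rule abelian_groupI)
    fix a show "\<exists>b\<in>carrier real_ring. b \<oplus>\<^bsub>real_ring\<^esub> a = \<zero>\<^bsub>real_ring\<^esub>"
      by (rule bexI[of _ "- a"]) (auto simp: real_ring_def)
  qed (auto simp: real_ring_def)
  show "Group.comm_monoid real_ring"
    by (rule comm_monoidI) (auto simp: real_ring_def)
qed (auto simp: real_ring_def algebra_simps)

lemma algebra_L0: "algebra real_ring (L0 M)"
proof (rule algebraI)
  show "cring (L0 M)"
  proof (rule cringI)
    show "abelian_group (L0 M)"
    proof (rule abelian_groupI)
      fix X assume "X \<in> carrier (L0 M)"
      then obtain f where [measurable]: "f \<in> borel_measurable M" and X: "X = ae_class M f"
        by (auto simp: carrier_L0)
      show "\<exists>Y\<in>carrier (L0 M). Y \<oplus>\<^bsub>L0 M\<^esub> X = \<zero>\<^bsub>L0 M\<^esub>"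
        by (rule bexI[of _ "ae_class M (\<lambda>x. - f x)"]) (auto simp: X L0_ops L0_units carrier_L0)
    qed (auto simp: carrier_L0 L0_ops L0_units algebra_simps)
    show "Group.comm_monoid (L0 M)"
      by (rule comm_monoidI) (auto simp: carrier_L0 L0_ops L0_units algebra_simps)
  qed (auto simp: carrier_L0 L0_ops L0_units algebra_simps)
qed (auto simp: carrier_L0 L0_ops L0_units algebra_simps cring_real_ring,
     auto simp: carrier_L0 L0_ops L0_units algebra_simps real_ring_def)

lemma algebra_seq_algebra:
  assumes "algebra R A"
  shows "algebra R (seq_algebra A)"
proof -
  interpret A: algebra R A by fact
  note D = fun_eq_iff A.M.a_assoc A.M.a_comm A.M.a_lcomm A.m_assoc A.m_comm A.m_lcomm A.l_distr A.r_distr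
  show ?thesis
  proof (rule algebraI)
    show "cring (seq_algebra A)"
    proof (rule cringI)
      show "abelian_group (seq_algebra A)"
      proof (rule abelian_groupI)
        fix s assume "s \<in> carrier (seq_algebra A)"
        then show "\<exists>t\<in>carrier (seq_algebra A). t \<oplus>\<^bsub>seq_algebra A\<^esub> s = \<zero>\<^bsub>seq_algebra A\<^esub>"
          by (intro bexI[of _ "\<lambda>n. \<ominus>\<^bsub>A\<^esub> s n"])
             (auto simp: seq_algebra_def A.M.l_neg PiE_iff Pi_iff)
      qed (auto simp: seq_algebra_def D Pi_iff)
      show "Group.comm_monoid (seq_algebra A)"
        by (rule comm_monoidI) (auto simp: seq_algebra_def D Pi_iff)
    qed (auto simp: seq_algebra_def D Pi_iff)
  qed (auto simp: seq_algebra_def fun_eq_iff Pi_iff A.R.is_cring A.smult_l_distr A.smult_r_distr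
      A.smult_assoc1 A.smult_assoc2)
qed

lemma seq_class_eqD:
  assumes "\<forall>n. f n \<in> borel_measurable M" "\<forall>n. g n \<in> borel_measurable M"
    and "seq_class M f = seq_class M g"
  shows "AE x in M. \<forall>n. f n x = g n x"
  using assms by (auto simp: AE_all_countable seq_class_def fun_eq_iff ae_class_eq_iff)

text \<open>Membership does not depend on the chosen representatives.\<close>

lemma seq_class_mem_iff:
  assumes "\<forall>n. f n \<in> borel_measurable M"
    and inv: "\<And>f g. \<forall>n. f n \<in> borel_measurable M \<Longrightarrow> \<forall>n. g n \<in> borel_measurable M \<Longrightarrow>
      AE x in M. \<forall>n. f n x = g n x \<Longrightarrow> Q f \<Longrightarrow> Q g"
  shows "seq_class M f \<in> {seq_class M f | f. (\<forall>n. f n \<in> borel_measurable M) \<and> Q f} \<longleftrightarrow> Q f"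
proof
  assume "seq_class M f \<in> {seq_class M f | f. (\<forall>n. f n \<in> borel_measurable M) \<and> Q f}"
  then obtain g where g: "seq_class M g = seq_class M f" "\<forall>n. g n \<in> borel_measurable M" "Q g"
    by (auto simp: eq_commute)
  then show "Q f"
    using inv[OF g(2) assms(1) seq_class_eqD[OF g(2) assms(1) g(1)]] by simp
qed (use assms(1) in auto)

lemma uniform_limit_AE_cong:
  assumes "AE x in M. \<forall>n. f n x = g n x" "Z \<in> sets M"
    and "uniform_limit (space M - Z) f (\<lambda>x. 0) sequentially"
  obtains Z' where "Z' \<in> sets M" "emeasure M Z' = emeasure M Z"
    "uniform_limit (space M - Z') g (\<lambda>x. 0 :: real) sequentially"
proof -
  obtain N where N: "{x \<in> space M. \<not> (\<forall>n. f n x = g n x)} \<subseteq> N" "N \<in> null_sets M"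
    using assms(1) by (auto elim!: AE_E intro: null_setsI)
  have "uniform_limit (space M - (Z \<union> N)) f (\<lambda>x. 0) sequentially"
    using assms(3) by (rule uniform_limit_on_subset) auto
  then have "uniform_limit (space M - (Z \<union> N)) g (\<lambda>x. 0) sequentially"
    by (rule uniform_limit_cong'[THEN iffD1, rotated -1]) (use N in auto)
  then show thesis
    using that[of "Z \<union> N"] N assms(2) by (auto simp: emeasure_Un_null_set)
qed

lemma S_p_iff:
  assumes "\<forall>n. f n \<in> borel_measurable M"
  shows "seq_class M f \<in> S_p M \<longleftrightarrow> (AE x in M. (\<lambda>n. f n x) \<longlonglongrightarrow> 0)"
  unfolding S_p_def
proof (rule seq_class_mem_iff[OF assms])
  fix f g :: "nat \<Rightarrow> 'a \<Rightarrow> real"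
  assume "AE x in M. \<forall>n. f n x = g n x" "AE x in M. (\<lambda>n. f n x) \<longlonglongrightarrow> 0"
  then show "AE x in M. (\<lambda>n. g n x) \<longlonglongrightarrow> 0"
    by eventually_elim simp
qed

lemma S_u_iff:
  assumes "\<forall>n. f n \<in> borel_measurable M"
  shows "seq_class M f \<in> S_u M \<longleftrightarrow>
    (\<exists>Z\<in>sets M. emeasure M Z = 0 \<and> uniform_limit (space M - Z) f (\<lambda>x. 0) sequentially)"
  unfolding S_u_def
proof (rule seq_class_mem_iff[OF assms])
  fix f g :: "nat \<Rightarrow> 'a \<Rightarrow> real"
  assume ae: "AE x in M. \<forall>n. f n x = g n x"
  assume "\<exists>Z\<in>sets M. emeasure M Z = 0 \<and> uniform_limit (space M - Z) f (\<lambda>x. 0) sequentially"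
  then obtain Z where Z: "Z \<in> sets M" "emeasure M Z = 0"
    "uniform_limit (space M - Z) f (\<lambda>x. 0) sequentially"
    by blast
  show "\<exists>Z\<in>sets M. emeasure M Z = 0 \<and> uniform_limit (space M - Z) g (\<lambda>x. 0) sequentially"
    by (rule uniform_limit_AE_cong[OF ae Z(1,3)]) (use Z(2) in auto)
qed

lemma S_au_iff:
  assumes "\<forall>n. f n \<in> borel_measurable M"
  shows "seq_class M f \<in> S_au M \<longleftrightarrow>
    (\<forall>\<epsilon>>0. \<exists>Z\<in>sets M. emeasure M Z < ennreal \<epsilon> \<and>
        uniform_limit (space M - Z) f (\<lambda>x. 0) sequentially)"
  unfolding S_au_def
proof (rule seq_class_mem_iff[OF assms], intro allI impI)
  fix f g :: "nat \<Rightarrow> 'a \<Rightarrow> real" and \<epsilon> :: real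
  assume ae: "AE x in M. \<forall>n. f n x = g n x" and "\<epsilon> > 0"
  assume "\<forall>\<epsilon>>0. \<exists>Z\<in>sets M. emeasure M Z < ennreal \<epsilon> \<and>
    uniform_limit (space M - Z) f (\<lambda>x. 0) sequentially"
  with \<open>\<epsilon> > 0\<close> obtain Z where Z: "Z \<in> sets M" "emeasure M Z < ennreal \<epsilon>"
    "uniform_limit (space M - Z) f (\<lambda>x. 0) sequentially"
    by blast
  obtain Z' where "Z' \<in> sets M" "emeasure M Z' = emeasure M Z"
    "uniform_limit (space M - Z') g (\<lambda>x. 0) sequentially"
    by (rule uniform_limit_AE_cong[OF ae Z(1,3)])
  with Z(2) show "\<exists>Z\<in>sets M. emeasure M Z < ennreal \<epsilon> \<and>
    uniform_limit (space M - Z) g (\<lambda>x. 0) sequentially"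
    by (intro bexI[of _ Z']) simp_all
qed

lemma S_m_iff:
  assumes "\<forall>n. f n \<in> borel_measurable M"
  shows "seq_class M f \<in> S_m M \<longleftrightarrow>
    (\<forall>\<epsilon>>0. (\<lambda>n. emeasure M {x \<in> space M. \<bar>f n x\<bar> > \<epsilon>}) \<longlonglongrightarrow> 0)"
  unfolding S_m_def
proof (rule seq_class_mem_iff[OF assms])
  fix f g :: "nat \<Rightarrow> 'a \<Rightarrow> real"
  assume [measurable]: "\<forall>n. f n \<in> borel_measurable M" "\<forall>n. g n \<in> borel_measurable M"
    and ae: "AE x in M. \<forall>n. f n x = g n x"
    and lim: "\<forall>\<epsilon>>0. (\<lambda>n. emeasure M {x \<in> space M. \<bar>f n x\<bar> > \<epsilon>}) \<longlonglongrightarrow> 0"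
  have [measurable]: "f n \<in> borel_measurable M" "g n \<in> borel_measurable M" for n
    by (simp_all add: \<open>\<forall>n. f n \<in> _\<close> \<open>\<forall>n. g n \<in> _\<close>)
  have "emeasure M {x \<in> space M. \<bar>f n x\<bar> > \<epsilon>} = emeasure M {x \<in> space M. \<bar>g n x\<bar> > \<epsilon>}" for n \<epsilon>
    by (rule emeasure_eq_AE) (use ae in auto)
  then show "\<forall>\<epsilon>>0. (\<lambda>n. emeasure M {x \<in> space M. \<bar>g n x\<bar> > \<epsilon>}) \<longlonglongrightarrow> 0"
    using lim by simp
qed

lemma S_L_iff:
  assumes "\<forall>n. f n \<in> borel_measurable M"
  shows "seq_class M f \<in> S_L M q \<longleftrightarrow>
    (\<lambda>n. \<integral>\<^sup>+ x. ennreal (\<bar>f n x\<bar> powr q) \<partial>M) \<longlonglongrightarrow> 0"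
  unfolding S_L_def
proof (rule seq_class_mem_iff[OF assms])
  fix f g :: "nat \<Rightarrow> 'a \<Rightarrow> real"
  assume ae: "AE x in M. \<forall>n. f n x = g n x"
    and lim: "(\<lambda>n. \<integral>\<^sup>+ x. ennreal (\<bar>f n x\<bar> powr q) \<partial>M) \<longlonglongrightarrow> 0"
  have "(\<integral>\<^sup>+ x. ennreal (\<bar>f n x\<bar> powr q) \<partial>M) = (\<integral>\<^sup>+ x. ennreal (\<bar>g n x\<bar> powr q) \<partial>M)" for n
    by (rule nn_integral_cong_AE) (use ae in auto)
  then show "(\<lambda>n. \<integral>\<^sup>+ x. ennreal (\<bar>g n x\<bar> powr q) \<partial>M) \<longlonglongrightarrow> 0"
    using lim by simp
qed

end

theory Submission
  imports Defs
begin

text \<open>Sequences of constant functions suffice. If \<open>\<mu>(\<Omega>) = \<infinity>\<close> and \<open>a n \<rightarrow> 0\<close> with \<open>a n \<noteq> 0\<close> eventually,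
  then the constants \<open>a n\<close> converge uniformly to zero although \<open>\<integral>|a n|\<^sup>q d\<mu> = \<infinity>\<close> eventually, for each
  \<open>q > 0\<close>. As free generators we take the sequences \<open>a\<^sub>t n = exp (- n\<^sup>t)\<close> for \<open>t > 0\<close>: two different
  monomials in them are \<open>exp (- D n)\<close> and \<open>exp (- E n)\<close> with \<open>D - E\<close> tending to \<open>\<plusminus>\<infinity>\<close>, so that a
  polynomial in them is asymptotic to one of its terms and hence eventually nonzero.
  Conversely, on a finite measure space uniform convergence to zero implies convergence in \<open>L\<^sub>1\<close>.\<close>

section \<open>Asymptotics of combinations of powers and of exponentials\<close>

lemma filterlim_nat_powr_at_top:
  assumes "t > 0"
  shows "filterlim (\<lambda>n. real n powr t) at_top sequentially"
proof -
  have "(\<lambda>n. real n powr (- t)) \<longlonglongrightarrow> 0"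
    using assms by (intro tendsto_neg_powr filterlim_real_sequentially) simp
  moreover have "\<forall>\<^sub>F n in sequentially. 0 < real n powr (- t)"
    using eventually_gt_at_top[of 0] by eventually_elim simp
  ultimately show ?thesis
    using filterlim_inverse_at_top by (fastforce simp: powr_minus)
qed

text \<open>Among the terms with nonzero coefficient, the one with the largest exponent
  \<open>t j\<close> dominates: after division by \<open>real n powr t j\<close> the sum tends to
  \<open>c j\<close>. As \<open>t j\<close> is positive, that power diverges, and the sign of
  \<open>c j\<close> decides between the two alternatives.\<close>

lemma powr_combination_diverges:
  fixes c t :: "'i \<Rightarrow> real"
  assumes "finite I" "inj_on t I" "\<And>i. i \<in> I \<Longrightarrow> t i > 0" "\<exists>i\<in>I. c i \<noteq> 0"
  shows "filterlim (\<lambda>n. \<Sum>i\<in>I. c i * real n powr t i) at_top sequentially \<or>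
    filterlim (\<lambda>n. \<Sum>i\<in>I. c i * real n powr t i) at_bot sequentially"
proof -
  define J where "J = {i\<in>I. c i \<noteq> 0}"
  have J: "finite J" "J \<noteq> {}" "J \<subseteq> I"
    using assms by (auto simp: J_def)
  then have "Max (t ` J) \<in> t ` J"
    by (intro Max_in) auto
  then obtain j where j: "j \<in> J" "t j = Max (t ` J)"
    by auto
  have less: "t i < t j" if "i \<in> J - {j}" for i
  proof -
    have "t i \<le> t j"
      using J that unfolding j by auto
    moreover have "t i \<noteq> t j"
      using that j(1) J(3) inj_onD[OF assms(2), of i j] by blast
    ultimately show ?thesis
      by simp
  qed
  have summand: "(\<lambda>n. c i * real n powr (t i - t j)) \<longlonglongrightarrow> (if i = j then c j else 0)" if "i \<in> J" for i
  proof (cases "i = j")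
    case True
    \<comment> \<open>Only for positive \<open>n\<close>, because
      \<open>0 powr 0 = 0\<close>.\<close>
    have "eventually (\<lambda>n. c j = c i * real n powr (t i - t j)) sequentially"
      using eventually_gt_at_top[of 0] by eventually_elim (simp add: True)
    then have "\<forall>\<^sub>F n in sequentially. c i * real n powr (t i - t j) = c j"
      by eventually_elim simp
    with True show ?thesis
      by (simp add: tendsto_eventually)
  next
    case False
    then have "(\<lambda>n. real n powr (t i - t j)) \<longlonglongrightarrow> 0"
      using less that by (intro tendsto_neg_powr filterlim_real_sequentially) auto
    from tendsto_mult_right_zero[OF this] False show ?thesis
      by simp
  qed
  have "(\<lambda>n. \<Sum>i\<in>J. c i * real n powr (t i - t j)) \<longlonglongrightarrow> (\<Sum>i\<in>J. if i = j then c j else 0)"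
    by (intro tendsto_sum summand)
  then have quotient: "(\<lambda>n. \<Sum>i\<in>J. c i * real n powr (t i - t j)) \<longlonglongrightarrow> c j"
    using J(1) j(1) by simp
  have power: "filterlim (\<lambda>n. real n powr t j) at_top sequentially"
    using j(1) J(3) assms(3) by (intro filterlim_nat_powr_at_top) auto
  \<comment> \<open>This holds for every \<open>n\<close>, including 0, where all powers are
    0.\<close>
  have eq: "(\<Sum>i\<in>J. c i * real n powr (t i - t j)) * real n powr t j = (\<Sum>i\<in>I. c i * real n powr t i)"
    for n
  proof -
    have "(\<Sum>i\<in>J. c i * real n powr (t i - t j)) * real n powr t j = (\<Sum>i\<in>J. c i * real n powr t i)"
      by (simp add: sum_distrib_right mult.assoc flip: powr_add)
    also have "\<dots> = (\<Sum>i\<in>I. c i * real n powr t i)"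
      using assms(1) by (intro sum.mono_neutral_left) (auto simp: J_def)
    finally show ?thesis .
  qed
  consider "c j > 0" | "c j < 0"
    using j by (force simp: J_def)
  then show ?thesis
  proof cases
    case 1
    from filterlim_tendsto_pos_mult_at_top[OF quotient 1 power] show ?thesis
      unfolding eq ..
  next
    case 2
    from filterlim_tendsto_neg_mult_at_bot[OF quotient 2 power] show ?thesis
      unfolding eq ..
  qed
qed

text \<open>Divergence of the difference to infinity is a transitive relation, and by assumption any
  two distinct members are comparable, so a finite nonempty set has a least member. The least one is
  wanted because \<open>exp (- D k n)\<close> then decays most slowly.\<close>

lemma slowest_growing_member:
  fixes D :: "'k \<Rightarrow> nat \<Rightarrow> real"
  assumes "finite K" "K \<noteq> {}"
    and "\<And>k l. k \<in> K \<Longrightarrow> l \<in> K \<Longrightarrow> k \<noteq> l \<Longrightarrow>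
      filterlim (\<lambda>n. D k n - D l n) at_top sequentially \<or>
      filterlim (\<lambda>n. D l n - D k n) at_top sequentially"
  shows "\<exists>k\<in>K. \<forall>l\<in>K - {k}. filterlim (\<lambda>n. D l n - D k n) at_top sequentially"
  using assms
proof (induction rule: finite_ne_induct)
  case (insert a F)
  have "\<exists>k\<in>F. \<forall>l\<in>F - {k}. filterlim (\<lambda>n. D l n - D k n) at_top sequentially"
    by (rule insert.IH) (use insert.prems in blast)
  then obtain k where k: "k \<in> F"
    "\<And>l. l \<in> F - {k} \<Longrightarrow> filterlim (\<lambda>n. D l n - D k n) at_top sequentially"
    by blast
  show ?case
  proof (cases "filterlim (\<lambda>n. D a n - D k n) at_top sequentially")
    case True
    then show ?thesis
      using k by (intro bexI[of _ k]) blast+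
  next
    case False
    \<comment> \<open>If \<open>a\<close> does not outgrow the minimum \<open>k\<close> of
      \<open>F\<close>, then \<open>k\<close> outgrows \<open>a\<close>, and \<open>a\<close>
      becomes the new minimum.\<close>
    then have ka: "filterlim (\<lambda>n. D k n - D a n) at_top sequentially"
      using insert.prems[of a k] insert.hyps k(1) by blast
    have "filterlim (\<lambda>n. D l n - D a n) at_top sequentially" if "l \<in> F" for l
    proof (cases "l = k")
      case False
      \<comment> \<open>The difference \<open>D l n - D a n\<close> is the sum of
        \<open>D l n - D k n\<close> and \<open>D k n - D a n\<close>.\<close>
      from filterlim_at_top_add_at_top[OF k(2) ka] False that show ?thesis
        by simp
    qed (use ka in simp)
    then show ?thesis
      by (intro bexI[of _ a]) blast+
  qed
qed simp

text \<open>Multiplying by \<open>exp (D k n)\<close> for the slowest growing \<open>D k\<close>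
  makes every other term vanish in the limit, so that the rescaled sum tends to \<open>c k\<close>,
  which is nonzero.\<close>

lemma eventually_exp_combination_nonzero:
  fixes D :: "'k \<Rightarrow> nat \<Rightarrow> real" and c :: "'k \<Rightarrow> real"
  assumes "finite K" "K \<noteq> {}" "\<And>k. k \<in> K \<Longrightarrow> c k \<noteq> 0"
    and "\<And>k l. k \<in> K \<Longrightarrow> l \<in> K \<Longrightarrow> k \<noteq> l \<Longrightarrow>
      filterlim (\<lambda>n. D k n - D l n) at_top sequentially \<or>
      filterlim (\<lambda>n. D l n - D k n) at_top sequentially"
  shows "\<forall>\<^sub>F n in sequentially. (\<Sum>k\<in>K. c k * exp (- D k n)) \<noteq> 0"
proof -
  from slowest_growing_member[OF assms(1,2,4)] obtain k where k: "k \<in> K"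
    and slowest: "\<forall>l\<in>K - {k}. filterlim (\<lambda>n. D l n - D k n) at_top sequentially" ..
  have summand: "(\<lambda>n. c l * exp (- (D l n - D k n))) \<longlonglongrightarrow> (if l = k then c k else 0)" if "l \<in> K" for l
  proof (cases "l = k")
    case False
    then have "filterlim (\<lambda>n. - (D l n - D k n)) at_bot sequentially"
      using iffD1[OF filterlim_uminus_at_top bspec[OF slowest, of l]] that by simp
    then have "(\<lambda>n. c l * exp (- (D l n - D k n))) \<longlonglongrightarrow> 0"
      by (intro tendsto_mult_right_zero filterlim_compose[OF exp_at_bot])
    with False show ?thesis
      by simp
  qed simp
  have "(\<lambda>n. \<Sum>l\<in>K. c l * exp (- (D l n - D k n))) \<longlonglongrightarrow> (\<Sum>l\<in>K. if l = k then c k else 0)"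
    by (intro tendsto_sum summand)
  then have "(\<lambda>n. \<Sum>l\<in>K. c l * exp (- (D l n - D k n))) \<longlonglongrightarrow> c k"
    using assms(1) k by simp
  then have "\<forall>\<^sub>F n in sequentially. (\<Sum>l\<in>K. c l * exp (- (D l n - D k n))) \<noteq> 0"
    by (rule tendsto_imp_eventually_ne) (use assms(3) k in simp)
  then show ?thesis
  proof eventually_elim
    case (elim n)
    have "(\<Sum>l\<in>K. c l * exp (- (D l n - D k n))) = (\<Sum>l\<in>K. c l * exp (- D l n)) * exp (D k n)"
      by (simp add: sum_distrib_right mult.assoc flip: exp_add)
    with elim show ?case
      by auto
  qed
qed

section \<open>Polynomials evaluated at the real generators\<close>

definition real_poly_eval :: "nat \<Rightarrow> ((nat \<Rightarrow>\<^sub>0 nat) \<Rightarrow>\<^sub>0 real) \<Rightarrow> (nat \<Rightarrow> real) \<Rightarrow> real" where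
  "real_poly_eval N P a =
     (\<Sum>m\<in>Poly_Mapping.keys P. Poly_Mapping.lookup P m * (\<Prod>i<N. a i ^ Poly_Mapping.lookup m i))"

text \<open>Without a constant term, every monomial contains some variable to a positive power, and
  hence a factor that tends to 0 while the remaining factors converge.\<close>

lemma real_poly_eval_tendsto_0:
  assumes "polynomial_in N P" "Poly_Mapping.lookup P 0 = 0" "\<And>i. i < N \<Longrightarrow> (\<lambda>n. a n i) \<longlonglongrightarrow> 0"
  shows "(\<lambda>n. real_poly_eval N P (a n)) \<longlonglongrightarrow> 0"
proof -
  have "(\<lambda>n. Poly_Mapping.lookup P m * (\<Prod>i<N. a n i ^ Poly_Mapping.lookup m i)) \<longlonglongrightarrow> 0"
    if m: "m \<in> Poly_Mapping.keys P" for m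
  proof -
    have "m \<noteq> 0"
      using m assms(2) by (auto simp: in_keys_iff)
    then obtain i where "i \<in> Poly_Mapping.keys m"
      by (metis all_not_in_conv keys_eq_empty)
    then have "Poly_Mapping.lookup m i \<noteq> 0"
      by (simp add: in_keys_iff)
    moreover have "i < N"
      using m assms(1) \<open>i \<in> Poly_Mapping.keys m\<close> unfolding polynomial_in_def by blast
    ultimately have zero: "(\<Prod>i<N. (0::real) ^ Poly_Mapping.lookup m i) = 0"
      by (intro prod_zero) auto
    have "(\<lambda>n. \<Prod>i<N. a n i ^ Poly_Mapping.lookup m i) \<longlonglongrightarrow>
        (\<Prod>i<N. 0 ^ Poly_Mapping.lookup m i)"
      using assms(3) by (intro tendsto_prod tendsto_power) auto
    then show ?thesis
      unfolding zero by (rule tendsto_mult_right_zero)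
  qed
  then show ?thesis
    unfolding real_poly_eval_def by (rule tendsto_null_sum)
qed

definition generator :: "real \<Rightarrow> nat \<Rightarrow> real" where
  "generator t n = exp (- (real n powr t))"

lemma generator_tendsto_0:
  assumes "t > 0"
  shows "generator t \<longlonglongrightarrow> 0"
proof -
  have "filterlim (\<lambda>n. - (real n powr t)) at_bot sequentially"
    by (rule iffD1[OF filterlim_uminus_at_top filterlim_nat_powr_at_top[OF assms]])
  from filterlim_compose[OF exp_at_bot this] show ?thesis
    by (simp add: generator_def[abs_def])
qed

lemma inj_generator: "inj generator"
proof (rule injI)
  fix s t assume "generator s = generator t"
  \<comment> \<open>The indices 0 and 1 cannot separate exponents, since \<open>0 powr t = 0\<close>
    and \<open>1 powr t = 1\<close>.\<close>
  then have "generator s 2 = generator t 2"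
    by simp
  then show "s = t"
    by (simp add: generator_def powr_inj)
qed

text \<open>At the generators, the monomial \<open>m\<close> becomes \<open>exp (- D m n)\<close>,
  where \<open>D m n\<close> combines the powers \<open>real n powr t i\<close> with the exponents
  of \<open>m\<close> as coefficients. Two distinct monomials differ in some exponent, so the
  difference of their \<open>D\<close> is a nontrivial combination of powers with distinct positive
  exponents and diverges.\<close>

lemma eventually_real_poly_eval_generator_nonzero:
  assumes "polynomial_in N P" "P \<noteq> 0" "inj_on t {..<N}" "\<And>i. i < N \<Longrightarrow> t i > 0"
  shows "\<forall>\<^sub>F n in sequentially. real_poly_eval N P (\<lambda>i. generator (t i) n) \<noteq> 0"
proof -
  define D where "D m n = (\<Sum>i<N. real (Poly_Mapping.lookup m i) * real n powr t i)" for m n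
  have monomial: "(\<Prod>i<N. generator (t i) n ^ Poly_Mapping.lookup m i) = exp (- D m n)" for m n
  proof -
    have "generator (t i) n ^ Poly_Mapping.lookup m i = exp (- (Poly_Mapping.lookup m i * real n powr t i))"
      for i
      by (simp add: generator_def flip: exp_of_nat_mult)
    then show ?thesis
      by (simp add: D_def exp_sum flip: sum_negf)
  qed
  have "\<forall>\<^sub>F n in sequentially.
    (\<Sum>m\<in>Poly_Mapping.keys P. Poly_Mapping.lookup P m * exp (- D m n)) \<noteq> 0"
  proof (rule eventually_exp_combination_nonzero[where c = "Poly_Mapping.lookup P" and D = D])
    fix k l assume kl: "k \<in> Poly_Mapping.keys P" "l \<in> Poly_Mapping.keys P" "k \<noteq> l"
    define c where "c i = real (Poly_Mapping.lookup k i) - real (Poly_Mapping.lookup l i)" for i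
    obtain i where i: "Poly_Mapping.lookup k i \<noteq> Poly_Mapping.lookup l i"
      using kl(3) poly_mapping_eqI[of k l] by metis
    then have "i \<in> Poly_Mapping.keys k \<union> Poly_Mapping.keys l"
      by (auto simp: in_keys_iff)
    then have "i < N"
      using assms(1) kl by (auto simp: polynomial_in_def)
    with i have "\<exists>i\<in>{..<N}. c i \<noteq> 0"
      by (auto simp: c_def)
    moreover have "(\<Sum>i<N. c i * real n powr t i) = D k n - D l n" for n
      by (simp add: c_def D_def left_diff_distrib sum_subtractf)
    ultimately have "filterlim (\<lambda>n. D k n - D l n) at_top sequentially \<or>
        filterlim (\<lambda>n. D k n - D l n) at_bot sequentially"
      using powr_combination_diverges[of "{..<N}" t c] assms(3,4) by simp
    then show "filterlim (\<lambda>n. D k n - D l n) at_top sequentially \<or>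
        filterlim (\<lambda>n. D l n - D k n) at_top sequentially"
      by (simp add: filterlim_uminus_at_bot)
  qed (use assms(2) in \<open>auto simp: in_keys_iff\<close>)
  then show ?thesis
    by (simp add: real_poly_eval_def monomial)
qed

section \<open>Sequences of constant functions inside the algebra\<close>

definition const_seq :: "'a measure \<Rightarrow> (nat \<Rightarrow> real) \<Rightarrow> (nat \<Rightarrow> ('a \<Rightarrow> real) set)" where
  "const_seq M a = seq_class M (\<lambda>n _. a n)"

lemma const_seq_carrier: "const_seq M a \<in> carrier (seq_algebra (L0 M))"
  by (auto simp: seq_algebra_def carrier_L0 const_seq_def seq_class_def)

text \<open>With the units below, this makes \<open>const_seq\<close> a homomorphism from real
  sequences, so that computations with classes reduce to real arithmetic at each index.\<close>

lemma const_seq_ops: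
  "const_seq M a \<otimes>\<^bsub>seq_algebra (L0 M)\<^esub> const_seq M b = const_seq M (\<lambda>n. a n * b n)"
  "const_seq M a \<oplus>\<^bsub>seq_algebra (L0 M)\<^esub> const_seq M b = const_seq M (\<lambda>n. a n + b n)"
  "c \<odot>\<^bsub>seq_algebra (L0 M)\<^esub> const_seq M a = const_seq M (\<lambda>n. c * a n)"
  \<comment> \<open>In the scalar rule \<open>g\<close> occurs only in a premise and must be
    instantiated; the zero function is measurable.\<close>
  by (simp_all add: seq_algebra_def const_seq_def seq_class_def L0_ops[where g = "\<lambda>_. 0"] L0_ops(1,2))

lemma const_seq_units:
  "\<one>\<^bsub>seq_algebra (L0 M)\<^esub> = const_seq M (\<lambda>n. 1)" "\<zero>\<^bsub>seq_algebra (L0 M)\<^esub> = const_seq M (\<lambda>n. 0)"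
  by (simp_all add: seq_algebra_def const_seq_def seq_class_def L0_units)

lemma cring_seq_L0: "cring (seq_algebra (L0 M))"
  by (rule algebra.axioms(2)[OF algebra_seq_algebra[OF algebra_L0]])

lemma const_seq_pow:
  "const_seq M a [^]\<^bsub>seq_algebra (L0 M)\<^esub> (k::nat) = const_seq M (\<lambda>n. a n ^ k)"
proof -
  interpret cring "seq_algebra (L0 M)" by (rule cring_seq_L0)
  show ?thesis
    by (induction k) (simp_all add: const_seq_units const_seq_ops mult.commute)
qed

lemma const_seq_finprod:
  assumes "finite I"
  shows "(\<Otimes>\<^bsub>seq_algebra (L0 M)\<^esub> i\<in>I. const_seq M (a i)) = const_seq M (\<lambda>n. \<Prod>i\<in>I. a i n)"
proof -
  interpret cring "seq_algebra (L0 M)" by (rule cring_seq_L0)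
  show ?thesis
    using assms by induction (simp_all add: const_seq_units const_seq_ops const_seq_carrier)
qed

lemma const_seq_finsum:
  assumes "finite I"
  shows "(\<Oplus>\<^bsub>seq_algebra (L0 M)\<^esub> i\<in>I. const_seq M (a i)) = const_seq M (\<lambda>n. \<Sum>i\<in>I. a i n)"
proof -
  interpret cring "seq_algebra (L0 M)" by (rule cring_seq_L0)
  show ?thesis
    using assms by induction (simp_all add: const_seq_units const_seq_ops const_seq_carrier)
qed

lemma poly_eval_const_seq:
  assumes "\<And>i. i < N \<Longrightarrow> x i = const_seq M (a i)"
  shows "poly_eval (seq_algebra (L0 M)) N P x = const_seq M (\<lambda>n. real_poly_eval N P (\<lambda>i. a i n))"
proof -
  interpret cring "seq_algebra (L0 M)" by (rule cring_seq_L0)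
  have "(\<Otimes>\<^bsub>seq_algebra (L0 M)\<^esub> i\<in>{..<N}. x i [^]\<^bsub>seq_algebra (L0 M)\<^esub> Poly_Mapping.lookup m i) =
      (\<Otimes>\<^bsub>seq_algebra (L0 M)\<^esub> i\<in>{..<N}. const_seq M (\<lambda>n. a i n ^ Poly_Mapping.lookup m i))" for m
    by (rule finprod_cong') (auto simp: assms const_seq_pow const_seq_carrier)
  then show ?thesis
    by (simp add: poly_eval_def real_poly_eval_def const_seq_finprod const_seq_finsum const_seq_ops)
qed

text \<open>An equation between constants does not depend on the point; if it held almost everywhere
  but were false, the whole space would be null.\<close>

lemma const_seq_inj:
  assumes "emeasure M (space M) > 0" "const_seq M a = const_seq M b"
  shows "a = b"
proof -
  have "AE x in M. \<forall>n. a n = b n"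
    using assms(2) by (intro seq_class_eqD) (auto simp: const_seq_def)
  then have "AE x in M. a = b"
    by (simp add: fun_eq_iff)
  then show ?thesis
    using assms(1) by (cases "a = b") (simp_all add: AE_iff_measurable[OF _ refl])
qed

lemma const_seq_in_S_u:
  assumes "a \<longlonglongrightarrow> 0"
  shows "const_seq M a \<in> S_u M"
proof -
  have "uniform_limit (space M - {}) (\<lambda>n _. a n) (\<lambda>_. 0) sequentially"
    using assms by (auto simp: uniform_limit_iff tendsto_iff elim: eventually_mono)
  then show ?thesis
    unfolding const_seq_def by (subst S_u_iff) (auto intro!: bexI[of _ "{}"])
qed

lemma const_seq_notin_S_L:
  assumes "emeasure M (space M) = \<infinity>" "\<forall>\<^sub>F n in sequentially. a n \<noteq> 0"
  shows "const_seq M a \<notin> S_L M q"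
proof
  assume "const_seq M a \<in> S_L M q"
  then have "(\<lambda>n. \<integral>\<^sup>+ x. ennreal (\<bar>a n\<bar> powr q) \<partial>M) \<longlonglongrightarrow> 0"
    by (simp add: const_seq_def S_L_iff)
  then have "\<forall>\<^sub>F n in sequentially. (\<integral>\<^sup>+ x. ennreal (\<bar>a n\<bar> powr q) \<partial>M) < 1"
    by (rule order_tendstoD) simp
  \<comment> \<open>Whenever \<open>a n\<close> is nonzero, the integral is a positive constant
    times infinity, which contradicts the bound 1.\<close>
  with assms(2) have "\<forall>\<^sub>F n in sequentially. False"
    by eventually_elim (simp add: assms(1) ennreal_mult_top)
  then show False
    by simp
qed

text \<open>Consequently any element outside \<open>S_L M q\<close> is nonzero, which settles the
  nonvanishing demanded by strong algebrability.\<close>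

lemma zero_in_S_L: "\<zero>\<^bsub>seq_algebra (L0 M)\<^esub> \<in> S_L M q"
  by (simp add: const_seq_units const_seq_def S_L_iff)

section \<open>Uniform convergence compared with the other modes\<close>

lemma S_uE:
  assumes "s \<in> S_u M"
  obtains f Z where "s = seq_class M f" "\<forall>n. f n \<in> borel_measurable M"
    "Z \<in> sets M" "emeasure M Z = 0" "AE x in M. x \<in> space M - Z"
    "uniform_limit (space M - Z) f (\<lambda>x. 0) sequentially"
proof -
  obtain f Z where f: "s = seq_class M f" "\<forall>n. f n \<in> borel_measurable M"
    and Z: "Z \<in> sets M" "emeasure M Z = 0"
    and lim: "uniform_limit (space M - Z) f (\<lambda>x. 0) sequentially"
    using assms by (auto simp: S_u_def)
  have "AE x in M. x \<in> space M - Z"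
    using Z AE_not_in[of Z M] by (auto simp: null_sets_def)
  from that[OF f Z this lim] show thesis .
qed

text \<open>Off the null set \<open>Z\<close>, eventually
  \<open>\<bar>f n x\<bar> < \<epsilon>\<close>, so the integral is at most \<epsilon> times the
  measure of the space. Finiteness of that measure makes this bound arbitrarily small.\<close>

lemma S_u_subset_S_L1:
  assumes "emeasure M (space M) \<noteq> \<infinity>"
  shows "S_u M \<subseteq> S_L M 1"
proof
  fix s assume "s \<in> S_u M"
  then obtain f Z where s: "s = seq_class M f" and f: "\<forall>n. f n \<in> borel_measurable M"
    and Z: "Z \<in> sets M" "emeasure M Z = 0" "AE x in M. x \<in> space M - Z"
    and lim: "uniform_limit (space M - Z) f (\<lambda>x. 0) sequentially"
    by (rule S_uE)
  have bound: "\<forall>\<^sub>F n in sequentially. (\<integral>\<^sup>+ x. ennreal (\<bar>f n x\<bar> powr 1) \<partial>M) \<le> emeasure M (space M) * ennreal \<epsilon>"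
    if "\<epsilon> > 0" for \<epsilon> :: real
    using uniform_limitD[OF lim that]
  proof eventually_elim
    case (elim n)
    have "(\<integral>\<^sup>+ x. ennreal (\<bar>f n x\<bar> powr 1) \<partial>M) \<le> (\<integral>\<^sup>+ x. ennreal \<epsilon> \<partial>M)"
    proof (rule nn_integral_mono_AE)
      show "AE x in M. ennreal (\<bar>f n x\<bar> powr 1) \<le> ennreal \<epsilon>"
        using Z(3)
      proof eventually_elim
        case (elim x)
        with \<open>\<forall>x\<in>space M - Z. dist (f n x) 0 < \<epsilon>\<close> show ?case
          by (intro ennreal_leI) (auto intro: less_imp_le)
      qed
    qed
    then show ?case
      by (simp add: mult.commute)
  qed
  have "(\<lambda>n. \<integral>\<^sup>+ x. ennreal (\<bar>f n x\<bar> powr 1) \<partial>M) \<longlonglongrightarrow> 0"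
  proof (rule order_tendstoI)
    fix e :: ennreal assume "0 < e"
    \<comment> \<open>Multiplication by a finite measure is continuous at 0; this supplies a
      positive \<epsilon> whose bound lies below \<open>e\<close>.\<close>
    have "((\<lambda>\<epsilon>. emeasure M (space M) * ennreal \<epsilon>) \<longlongrightarrow> emeasure M (space M) * ennreal 0) (at_right 0)"
      using assms by (intro ennreal_tendsto_cmult tendsto_ennrealI tendsto_ident_at) (simp add: less_top)
    with \<open>0 < e\<close> have "\<forall>\<^sub>F \<epsilon> in at_right 0. emeasure M (space M) * ennreal \<epsilon> < e"
      by (auto dest: order_tendstoD)
    then have "\<forall>\<^sub>F \<epsilon> in at_right 0. \<epsilon> > 0 \<and> emeasure M (space M) * ennreal \<epsilon> < e"
      using eventually_at_right_less[of "0::real"] by (rule eventually_conj[rotated])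
    then obtain \<epsilon> :: real where "\<epsilon> > 0" "emeasure M (space M) * ennreal \<epsilon> < e"
      using eventually_happens'[OF trivial_limit_at_right_real] by blast
    with bound[of \<epsilon>] show "\<forall>\<^sub>F n in sequentially. (\<integral>\<^sup>+ x. ennreal (\<bar>f n x\<bar> powr 1) \<partial>M) < e"
      by (auto elim!: eventually_mono)
  qed simp
  then show "s \<in> S_L M 1"
    using f by (simp add: s S_L_iff)
qed

lemma S_u_subset_S_au: "S_u M \<subseteq> S_au M"
proof
  fix s assume "s \<in> S_u M"
  then obtain f Z where s: "s = seq_class M f" and f: "\<forall>n. f n \<in> borel_measurable M"
    and Z: "Z \<in> sets M" "emeasure M Z = 0" "AE x in M. x \<in> space M - Z"
    and lim: "uniform_limit (space M - Z) f (\<lambda>x. 0) sequentially"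
    by (rule S_uE)
  have "\<exists>Z\<in>sets M. emeasure M Z < ennreal \<epsilon> \<and> uniform_limit (space M - Z) f (\<lambda>x. 0) sequentially"
    if "\<epsilon> > 0" for \<epsilon>
    using that Z lim by (intro bexI[of _ Z]) simp_all
  then show "s \<in> S_au M"
    using f by (simp add: s S_au_iff)
qed

lemma S_u_subset_S_p: "S_u M \<subseteq> S_p M"
proof
  fix s assume "s \<in> S_u M"
  then obtain f Z where s: "s = seq_class M f" and f: "\<forall>n. f n \<in> borel_measurable M"
    and Z: "Z \<in> sets M" "emeasure M Z = 0" "AE x in M. x \<in> space M - Z"
    and lim: "uniform_limit (space M - Z) f (\<lambda>x. 0) sequentially"
    by (rule S_uE)
  have "AE x in M. (\<lambda>n. f n x) \<longlonglongrightarrow> 0"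
    using Z(3)
    by eventually_elim (rule tendsto_uniform_limitI[OF lim])
  then show "s \<in> S_p M"
    using f by (simp add: s S_p_iff)
qed

lemma S_u_subset_S_m: "S_u M \<subseteq> S_m M"
proof
  fix s assume "s \<in> S_u M"
  then obtain f Z where s: "s = seq_class M f" and f: "\<forall>n. f n \<in> borel_measurable M"
    and Z: "Z \<in> sets M" "emeasure M Z = 0" "AE x in M. x \<in> space M - Z"
    and lim: "uniform_limit (space M - Z) f (\<lambda>x. 0) sequentially"
    by (rule S_uE)
  have "(\<lambda>n. emeasure M {x \<in> space M. \<bar>f n x\<bar> > \<epsilon>}) \<longlonglongrightarrow> 0" if "\<epsilon> > 0" for \<epsilon>
  proof (rule tendsto_eventually)
    show "\<forall>\<^sub>F n in sequentially. emeasure M {x \<in> space M. \<bar>f n x\<bar> > \<epsilon>} = 0"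
      using uniform_limitD[OF lim that]
    proof eventually_elim
      case (elim n)
      \<comment> \<open>For large \<open>n\<close> the set where \<open>f n\<close> exceeds
        \<epsilon> lies inside \<open>Z\<close>, so its measure is exactly 0.\<close>
      then have "{x \<in> space M. \<bar>f n x\<bar> > \<epsilon>} \<subseteq> Z"
        by force
      from emeasure_mono[OF this Z(1)] Z(2) show ?case
        by simp
    qed
  qed
  then show "s \<in> S_m M"
    using f by (simp add: s S_m_iff)
qed

section \<open>Strong algebrability and the equivalences\<close>

lemma strongly_continuum_algebrable_mono:
  assumes "strongly_continuum_algebrable A S" "S \<subseteq> T"
  shows "strongly_continuum_algebrable A T"
proof -
  obtain B where B: "B \<subseteq> carrier A" "B \<approx> (UNIV :: real set)"
    and eval: "\<forall>N P x. N > 0 \<and> polynomial_in N P \<and> P \<noteq> 0 \<and> Poly_Mapping.lookup P 0 = 0 \<and>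
      inj_on x {..<N} \<and> x ` {..<N} \<subseteq> B \<longrightarrow> poly_eval A N P x \<in> S - {\<zero>\<^bsub>A\<^esub>}"
    using assms(1) unfolding strongly_continuum_algebrable_def by blast
  have "S - {\<zero>\<^bsub>A\<^esub>} \<subseteq> T - {\<zero>\<^bsub>A\<^esub>}"
    using assms(2) by blast
  then have "poly_eval A N P x \<in> T - {\<zero>\<^bsub>A\<^esub>}"
    if "N > 0 \<and> polynomial_in N P \<and> P \<noteq> 0 \<and> Poly_Mapping.lookup P 0 = 0 \<and>
      inj_on x {..<N} \<and> x ` {..<N} \<subseteq> B" for N P x
    using eval[rule_format, OF that] by (rule subsetD)
  with B show ?thesis
    unfolding strongly_continuum_algebrable_def by (intro exI[of _ B] conjI allI impI)
qed

text \<open>A set of continuum cardinality has a member, and the one-variable polynomial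
  \<open>X\<close> evaluated there yields an element of \<open>S\<close>.\<close>

lemma strongly_continuum_algebrable_nonempty:
  assumes "strongly_continuum_algebrable A S"
  shows "S \<noteq> {}"
proof -
  obtain B where B: "B \<approx> (UNIV :: real set)"
    and eval: "\<And>N P x. N > 0 \<Longrightarrow> polynomial_in N P \<Longrightarrow> P \<noteq> 0 \<Longrightarrow> Poly_Mapping.lookup P 0 = 0 \<Longrightarrow>
      inj_on x {..<N} \<Longrightarrow> x ` {..<N} \<subseteq> B \<Longrightarrow> poly_eval A N P x \<in> S - {\<zero>\<^bsub>A\<^esub>}"
    using assms unfolding strongly_continuum_algebrable_def by blast
  obtain b where "b \<in> B"
    using B by (metis UNIV_I empty_iff eqpoll_empty_iff_empty eqpoll_sym ex_in_conv)
  define X :: "(nat \<Rightarrow>\<^sub>0 nat) \<Rightarrow>\<^sub>0 real" where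
    "X = Poly_Mapping.single (Poly_Mapping.single 0 1) 1"
  have "poly_eval A 1 X (\<lambda>_. b) \<in> S - {\<zero>\<^bsub>A\<^esub>}"
  proof (rule eval)
    have "Poly_Mapping.single (0::nat) (1::nat) \<noteq> 0"
      by (metis lookup_single_eq lookup_zero one_neq_zero)
    then show "Poly_Mapping.lookup X 0 = 0"
      by (simp add: X_def lookup_single when_def)
    show "X \<noteq> 0"
      unfolding X_def by (metis lookup_single_eq lookup_zero one_neq_zero)
  qed (use \<open>b \<in> B\<close> in \<open>auto simp: polynomial_in_def X_def inj_on_def\<close>)
  then show ?thesis
    by blast
qed

lemma strongly_continuum_algebrable_S_u_minus_S_L:
  assumes "emeasure M (space M) = \<infinity>"
  shows "strongly_continuum_algebrable (seq_algebra (L0 M)) (S_u M - (\<Union>q\<in>{0<..}. S_L M q))"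
proof -
  \<comment> \<open>The substitution \<open>t = exp r\<close> parametrizes the positive exponents by
    all reals, so injectivity alone gives the cardinality of the continuum.\<close>
  define g where "g r = const_seq M (generator (exp r))" for r
  have "inj g"
  proof (rule injI)
    fix r s assume "g r = g s"
    then have "generator (exp r) = generator (exp s)"
      unfolding g_def by (rule const_seq_inj[rotated]) (simp add: assms)
    then show "r = s"
      using inj_generator by (simp add: inj_eq)
  qed
  then have card: "range g \<approx> (UNIV :: real set)"
    by (simp add: inj_on_image_eqpoll_self)
  have "poly_eval (seq_algebra (L0 M)) N P x \<in>
      S_u M - (\<Union>q\<in>{0<..}. S_L M q) - {\<zero>\<^bsub>seq_algebra (L0 M)\<^esub>}"
    if P: "polynomial_in N P" "P \<noteq> 0" "Poly_Mapping.lookup P 0 = 0"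
      and x: "inj_on x {..<N}" "x ` {..<N} \<subseteq> range g" for N P x
  proof -
    have "\<exists>r. x i = g r" if "i < N" for i
      using x(2) that by auto
    then obtain r where r: "\<And>i. i < N \<Longrightarrow> x i = g (r i)"
      by metis
    define p where "p n = real_poly_eval N P (\<lambda>i. generator (exp (r i)) n)" for n
    have eq: "poly_eval (seq_algebra (L0 M)) N P x = const_seq M p"
      unfolding p_def by (rule poly_eval_const_seq) (simp add: r g_def)
    \<comment> \<open>Equal exponents would give equal generators, whereas the \<open>x i\<close>
      are distinct.\<close>
    have "inj_on (\<lambda>i. exp (r i)) {..<N}"
      using x(1) by (auto simp: inj_on_def r)
    then have "\<forall>\<^sub>F n in sequentially. p n \<noteq> 0"
      unfolding p_def using P by (intro eventually_real_poly_eval_generator_nonzero) auto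
    then have notin: "const_seq M p \<notin> S_L M q" for q
      using assms by (rule const_seq_notin_S_L[rotated])
    moreover have "p \<longlonglongrightarrow> 0"
      unfolding p_def using P by (intro real_poly_eval_tendsto_0 generator_tendsto_0) auto
    ultimately show ?thesis
      using zero_in_S_L[of M 1] by (auto simp: eq const_seq_in_S_u)
  qed
  moreover have "range g \<subseteq> carrier (seq_algebra (L0 M))"
    by (auto simp: g_def const_seq_carrier)
  ultimately show ?thesis
    using card unfolding strongly_continuum_algebrable_def by blast
qed

theorem theorem4p5:
  fixes M :: "'a measure"
  assumes "emeasure M (space M) > 0"
  shows "(emeasure M (space M) = \<infinity> \<longleftrightarrow> S_u M - (\<Union>q\<in>{0<..}. S_L M q) \<noteq> {}) \<and>
    (S_u M - (\<Union>q\<in>{0<..}. S_L M q) \<noteq> {} \<longleftrightarrow>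
      strongly_continuum_algebrable (seq_algebra (L0 M)) (S_u M - (\<Union>q\<in>{0<..}. S_L M q))) \<and>
    (emeasure M (space M) = \<infinity> \<longrightarrow>
      strongly_continuum_algebrable (seq_algebra (L0 M)) (S_p M - (\<Union>q\<in>{0<..}. S_L M q)) \<and>
      strongly_continuum_algebrable (seq_algebra (L0 M)) (S_m M - (\<Union>q\<in>{0<..}. S_L M q)) \<and>
      strongly_continuum_algebrable (seq_algebra (L0 M)) (S_au M - (\<Union>q\<in>{0<..}. S_L M q)))"
proof -
  let ?L = "\<Union>q\<in>{0<..}. S_L M q"
  let ?alg = "strongly_continuum_algebrable (seq_algebra (L0 M))"
  \<comment> \<open>The single exponent 1 already removes all of \<open>S_u M\<close>.\<close>
  have finite: "S_u M - ?L = {}" if "emeasure M (space M) \<noteq> \<infinity>"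
    using S_u_subset_S_L1[OF that] by force
  have infinite: "?alg (S - ?L)" if "emeasure M (space M) = \<infinity>" "S_u M \<subseteq> S" for S
    by (rule strongly_continuum_algebrable_mono[OF strongly_continuum_algebrable_S_u_minus_S_L])
      (use that in auto)
  show ?thesis
  proof (cases "emeasure M (space M) = \<infinity>")
    case True
    then have "?alg (S_u M - ?L)" "?alg (S_p M - ?L)" "?alg (S_m M - ?L)" "?alg (S_au M - ?L)"
      by (intro infinite S_u_subset_S_p S_u_subset_S_m S_u_subset_S_au order_refl; simp)+
    with True strongly_continuum_algebrable_nonempty[of _ "S_u M - ?L"] show ?thesis
      by blast
  next
    case False
    \<comment> \<open>Here (a), (b) and (c) all fail: the difference is empty, and an empty set is
      not strongly algebrable.\<close>
    with finite[OF False] strongly_continuum_algebrable_nonempty[of _ "S_u M - ?L"] show ?thesis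
      by blast
  qed
qed

end
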